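(* Let $\tau$ be a nonzero cardinal number, $p\in[1,\infty]$, and let $\varphi:\tau\to\tau$ be a map with $\sigma_\varphi(\ell^p(\tau))\subseteq\ell^p(\tau)$. Let $\psi,\lambda:\ell^p(\tau)\to\ell^p(\tau)$ be continuous linear operators. Then $\sigma_\varphi\restriction_{\ell^p(\tau)}:\ell^p(\tau)\to\ell^p(\tau)$ is a $(\psi,\lambda)$-derivation if and only if there exists $(r_\alpha)_{\alpha<\tau}\in\mathbb{C}^\tau$ such that for all $(x_\alpha)_{\alpha<\tau}\in\ell^p(\tau)$, $$\psi((x_\alpha)_{\alpha<\tau})=(r_\alpha x_{\varphi(\alpha)})_{\alpha<\tau}\quad\text{and}\quad \lambda((x_\alpha)_{\alpha<\tau})=((1-r_\alpha)x_{\varphi(\alpha)})_{\alpha<\tau}.$$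
   Context: For a nonzero cardinal $\tau$ (regarded as the set of ordinals $\alpha<\tau$) and $p\in[1,\infty]$, $\ell^p(\tau)$ is the set of $x=(x_\alpha)_{\alpha<\tau}\in\mathbb{C}^\tau$ with $\|x\|_p<\infty$, where $\|x\|_p=(\sum_{\alpha<\tau}|x_\alpha|^p)^{1/p}$ for $p<\infty$ and $\|x\|_\infty=\sup_{\alpha<\tau}|x_\alpha|$. With the norm $\|\cdot\|_p$, pointwise sum and pointwise product it is a Banach algebra. For $\varphi:\tau\to\tau$, the generalized shift is $\sigma_\varphi:\mathbb{C}^\tau\to\mathbb{C}^\tau$, $(x_\alpha)_{\alpha<\tau}\mapsto(x_{\varphi(\alpha)})_{\alpha<\tau}$. For linear mappings $d,\psi,\lambda:\mathcal{A}\to\mathcal{A}$ on a Banach algebra $\mathcal{A}$, $d$ is a $(\psi,\lambda)$-derivation if $d(ab)=d(a)\psi(b)+\lambda(a)d(b)$ for all $a,b\in\mathcal{A}$. *)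

theory Defs
  imports "HOL-Analysis.Analysis"
begin

text \<open>
  A cardinal is a cardinal well-order \<open>\<tau>\<close> in the sense of the library (\<open>Card_order \<tau>\<close>), and
  \<open>Field \<tau>\<close> plays the role of the set of ordinals \<open>\<alpha> < \<tau>\<close>. Families indexed by \<open>Field \<tau>\<close> are
  extensional functions (\<open>undefined\<close> outside the index set), so that equality of families is
  equality of functions.
\<close>

definition families :: "'i rel \<Rightarrow> ('i \<Rightarrow> complex) set" where
  "families \<tau> = (Field \<tau> \<rightarrow>\<^sub>E UNIV)"

text \<open>
  The sum below is unordered and taken in \<open>ennreal\<close>, where it always exists; the outer case
  distinction is only needed because \<open>powr\<close> is not available on \<open>ennreal\<close>.
\<close>

definition lp_norm :: "ennreal \<Rightarrow> 'i rel \<Rightarrow> ('i \<Rightarrow> complex) \<Rightarrow> ennreal" where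
  "lp_norm p \<tau> x =
     (if p = \<infinity> then (SUP \<alpha>\<in>Field \<tau>. ennreal (cmod (x \<alpha>)))
      else let s = (\<Sum>\<^sub>\<infinity>\<alpha>\<in>Field \<tau>. ennreal (cmod (x \<alpha>) powr enn2real p))
           in if s = \<infinity> then \<infinity> else ennreal (enn2real s powr (1 / enn2real p)))"

definition lp :: "ennreal \<Rightarrow> 'i rel \<Rightarrow> ('i \<Rightarrow> complex) set" where
  "lp p \<tau> = {x \<in> families \<tau>. lp_norm p \<tau> x < \<infinity>}"

text \<open>Complex normed algebras, not necessarily unital, given by a carrier and operations.\<close>

record 'v normed_alg =
  acarrier :: "'v set"
  aadd :: "'v \<Rightarrow> 'v \<Rightarrow> 'v"
  ascale :: "complex \<Rightarrow> 'v \<Rightarrow> 'v"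
  amult :: "'v \<Rightarrow> 'v \<Rightarrow> 'v"
  anorm :: "'v \<Rightarrow> real"

definition adist :: "'v normed_alg \<Rightarrow> 'v \<Rightarrow> 'v \<Rightarrow> real" where
  "adist A a b = anorm A (aadd A a (ascale A (-1) b))"

definition alinear :: "'v normed_alg \<Rightarrow> ('v \<Rightarrow> 'v) \<Rightarrow> bool" where
  "alinear A f \<longleftrightarrow>
     f \<in> acarrier A \<rightarrow> acarrier A \<and>
     (\<forall>a\<in>acarrier A. \<forall>b\<in>acarrier A. f (aadd A a b) = aadd A (f a) (f b)) \<and>
     (\<forall>c. \<forall>a\<in>acarrier A. f (ascale A c a) = ascale A c (f a))"

definition acontinuous :: "'v normed_alg \<Rightarrow> ('v \<Rightarrow> 'v) \<Rightarrow> bool" where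
  "acontinuous A f \<longleftrightarrow>
     continuous_map (Metric_space.mtopology (acarrier A) (adist A))
                    (Metric_space.mtopology (acarrier A) (adist A)) f"

definition derivation :: "'v normed_alg \<Rightarrow> ('v \<Rightarrow> 'v) \<Rightarrow> ('v \<Rightarrow> 'v) \<Rightarrow> ('v \<Rightarrow> 'v) \<Rightarrow> bool" where
  "derivation A \<psi> \<Lambda> d \<longleftrightarrow>
     alinear A d \<and> alinear A \<psi> \<and> alinear A \<Lambda> \<and>
     (\<forall>a\<in>acarrier A. \<forall>b\<in>acarrier A.
        d (amult A a b) = aadd A (amult A (d a) (\<psi> b)) (amult A (\<Lambda> a) (d b)))"

definition lp_algebra :: "ennreal \<Rightarrow> 'i rel \<Rightarrow> ('i \<Rightarrow> complex) normed_alg" where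
  "lp_algebra p \<tau> =
     \<lparr>acarrier = lp p \<tau>,
      aadd = (\<lambda>x y. \<lambda>\<alpha>\<in>Field \<tau>. x \<alpha> + y \<alpha>),
      ascale = (\<lambda>c x. \<lambda>\<alpha>\<in>Field \<tau>. c * x \<alpha>),
      amult = (\<lambda>x y. \<lambda>\<alpha>\<in>Field \<tau>. x \<alpha> * y \<alpha>),
      anorm = (\<lambda>x. enn2real (lp_norm p \<tau> x))\<rparr>"

definition gen_shift :: "'i rel \<Rightarrow> ('i \<Rightarrow> 'i) \<Rightarrow> ('i \<Rightarrow> complex) \<Rightarrow> ('i \<Rightarrow> complex)" where
  "gen_shift \<tau> \<phi> x = (\<lambda>\<alpha>\<in>Field \<tau>. x (\<phi> \<alpha>))"

end

theory Submission
  imports Defs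
begin

text \<open>
  Let \<open>e\<close> be the unit vector at \<open>\<phi> \<alpha>\<close>. The derivation identity for \<open>a * e\<close> and for \<open>e * b\<close>,
  evaluated at \<open>\<alpha>\<close>, gives \<open>\<Lambda> a \<alpha> = (1 - \<psi> e \<alpha>) * a (\<phi> \<alpha>)\<close> and
  \<open>\<psi> b \<alpha> = (1 - \<Lambda> e \<alpha>) * b (\<phi> \<alpha>)\<close>. Hence \<open>r \<alpha> = \<psi> e \<alpha>\<close> works, since \<open>\<Lambda> e \<alpha> = 1 - \<psi> e \<alpha>\<close>.
\<close>

text \<open>In \<open>ennreal\<close> the infinite sum is the supremum of the finite partial sums,
  and a nonnegative real family is summable once these are bounded. This carries the sum in
  \<open>lp_norm\<close> over to real summability, where comparison arguments apply.\<close>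

lemma infsum_ennreal_less_top_iff:
  assumes "\<And>x. x \<in> A \<Longrightarrow> 0 \<le> f x"
  shows "(\<Sum>\<^sub>\<infinity>x\<in>A. ennreal (f x)) < \<infinity> \<longleftrightarrow> f summable_on A"
proof
  assume fin: "(\<Sum>\<^sub>\<infinity>x\<in>A. ennreal (f x)) < \<infinity>"
  let ?s = "\<Sum>\<^sub>\<infinity>x\<in>A. ennreal (f x)"
  have "sum f F \<le> enn2real ?s" if F: "F \<subseteq> A" "finite F" for F
  proof -
    have "ennreal (sum f F) = (\<Sum>x\<in>F. ennreal (f x))"
      using F assms by (intro sum_ennreal[symmetric]) auto
    also have "\<dots> \<le> ?s"
      unfolding nonneg_infsum_complete[of A "\<lambda>x. ennreal (f x)", simplified]
      using F by (intro SUP_upper) auto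
    also have "?s = ennreal (enn2real ?s)"
      using fin by simp
    finally show ?thesis
      by (simp add: ennreal_le_iff)
  qed
  then show "f summable_on A"
    by (intro nonneg_bdd_above_summable_on bdd_aboveI[of _ "enn2real ?s"]) (auto simp: assms)
next
  assume "f summable_on A"
  then have "(\<Sum>\<^sub>\<infinity>x\<in>A. ennreal (f x)) \<le> ennreal (infsum f A)"
    unfolding nonneg_infsum_complete[of A "\<lambda>x. ennreal (f x)", simplified]
    using assms
    by (intro SUP_least) (auto simp: subset_iff intro!: ennreal_leI finite_sum_le_infsum)
  then show "(\<Sum>\<^sub>\<infinity>x\<in>A. ennreal (f x)) < \<infinity>"
    by (simp add: order.strict_trans1)
qed

text \<open>The condition \<open>0 \<le> C\<close> holds the bound nonnegative even over an empty
  index set, so that such bounds can later be multiplied.\<close>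

lemma mem_lp_top:
  "x \<in> lp top \<tau> \<longleftrightarrow> x \<in> families \<tau> \<and> (\<exists>C\<ge>0. \<forall>\<alpha>\<in>Field \<tau>. cmod (x \<alpha>) \<le> C)"
proof -
  have "(SUP \<alpha>\<in>Field \<tau>. ennreal (cmod (x \<alpha>))) < \<infinity> \<longleftrightarrow> (\<exists>C\<ge>0. \<forall>\<alpha>\<in>Field \<tau>. cmod (x \<alpha>) \<le> C)"
    (is "?s < \<infinity> \<longleftrightarrow> ?R")
  proof
    assume "?s < \<infinity>"
    then have "?s = ennreal (enn2real ?s)"
      by simp
    moreover have "ennreal (cmod (x \<alpha>)) \<le> ?s" if "\<alpha> \<in> Field \<tau>" for \<alpha>
      using that by (rule SUP_upper)
    ultimately have "cmod (x \<alpha>) \<le> enn2real ?s" if "\<alpha> \<in> Field \<tau>" for \<alpha>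
      using that by (metis ennreal_le_iff enn2real_nonneg)
    then show ?R
      using enn2real_nonneg by blast
  next
    assume ?R
    then obtain C where "\<forall>\<alpha>\<in>Field \<tau>. cmod (x \<alpha>) \<le> C"
      by blast
    then have "?s \<le> ennreal C"
      by (intro SUP_least ennreal_leI) auto
    then show "?s < \<infinity>"
      by (simp add: order.strict_trans1)
  qed
  then show ?thesis
    by (simp add: lp_def lp_norm_def)
qed

text \<open>The outer power in \<open>lp_norm\<close> is applied to finite sums only and has a
  finite value, so finiteness of the norm is finiteness of the inner sum.\<close>

lemma mem_lp_finite:
  assumes "p \<noteq> top"
  shows "x \<in> lp p \<tau> \<longleftrightarrow>
    x \<in> families \<tau> \<and> (\<lambda>\<alpha>. cmod (x \<alpha>) powr enn2real p) summable_on Field \<tau>"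
  using assms infsum_ennreal_less_top_iff[of "Field \<tau>" "\<lambda>\<alpha>. cmod (x \<alpha>) powr enn2real p"]
  by (auto simp: lp_def lp_norm_def Let_def less_top)

text \<open>Membership alone is at stake, so a crude estimate replaces the Minkowski inequality: a
  sum is at most twice the larger of the two moduli, and the power of the maximum is at most the sum
  of the powers.\<close>

lemma lp_add:
  assumes "x \<in> lp p \<tau>" "y \<in> lp p \<tau>"
  shows "(\<lambda>\<alpha>\<in>Field \<tau>. x \<alpha> + y \<alpha>) \<in> lp p \<tau>"
proof (cases "p = top")
  case True
  with assms obtain C D where
    "\<forall>\<alpha>\<in>Field \<tau>. cmod (x \<alpha>) \<le> C" "\<forall>\<alpha>\<in>Field \<tau>. cmod (y \<alpha>) \<le> D" "0 \<le> C" "0 \<le> D"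
    by (auto simp: mem_lp_top)
  then have "0 \<le> C + D \<and> (\<forall>\<alpha>\<in>Field \<tau>. cmod (x \<alpha> + y \<alpha>) \<le> C + D)"
    by (auto intro: norm_triangle_le add_mono)
  then show ?thesis
    unfolding True mem_lp_top by (auto simp: families_def intro!: exI[of _ "C + D"])
next
  case False
  let ?q = "enn2real p"
  have bound: "cmod (x \<alpha> + y \<alpha>) powr ?q
      \<le> 2 powr ?q * (cmod (x \<alpha>) powr ?q + cmod (y \<alpha>) powr ?q)" for \<alpha>
  proof -
    let ?m = "max (cmod (x \<alpha>)) (cmod (y \<alpha>))"
    have "cmod (x \<alpha> + y \<alpha>) \<le> 2 * ?m"
      by (rule order.trans[OF norm_triangle_ineq]) auto
    then have "cmod (x \<alpha> + y \<alpha>) powr ?q \<le> 2 powr ?q * ?m powr ?q"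
      using powr_mono2[of ?q "cmod (x \<alpha> + y \<alpha>)" "2 * ?m"] by (simp add: powr_mult)
    also have "?m powr ?q \<le> cmod (x \<alpha>) powr ?q + cmod (y \<alpha>) powr ?q"
      by (auto simp: max_def)
    finally show ?thesis
      by simp
  qed
  have "(\<lambda>\<alpha>. 2 powr ?q * (cmod (x \<alpha>) powr ?q + cmod (y \<alpha>) powr ?q)) summable_on Field \<tau>"
    using assms False by (intro summable_on_cmult_right summable_on_add) (auto simp: mem_lp_finite)
  then have "(\<lambda>\<alpha>. cmod (x \<alpha> + y \<alpha>) powr ?q) summable_on Field \<tau>"
    by (rule summable_on_comparison_test) (use bound in auto)
  then show ?thesis
    unfolding mem_lp_finite[OF False] by (auto simp: families_def cong: summable_on_cong)
qed

text \<open>For finite \<open>p\<close> a single term is at most the whole sum of nonnegative terms;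
  taking the root of order \<open>p\<close>, possible as \<open>0 < p\<close>, bounds the
  entry.\<close>

lemma lp_bounded:
  assumes "x \<in> lp p \<tau>" "0 < p"
  obtains C where "0 \<le> C" "\<And>\<alpha>. \<alpha> \<in> Field \<tau> \<Longrightarrow> cmod (x \<alpha>) \<le> C"
proof (cases "p = top")
  case True
  then show ?thesis
    using assms that by (auto simp: mem_lp_top)
next
  case False
  let ?q = "enn2real p" and ?f = "\<lambda>\<alpha>. cmod (x \<alpha>) powr enn2real p"
  have q: "0 < ?q"
    using assms False by (simp add: enn2real_positive_iff less_top)
  have "?f summable_on Field \<tau>"
    using assms False by (simp add: mem_lp_finite)
  then have "sum ?f {\<alpha>} \<le> infsum ?f (Field \<tau>)" if "\<alpha> \<in> Field \<tau>" for \<alpha>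
    using that by (intro finite_sum_le_infsum) auto
  then have "?f \<alpha> powr (1 / ?q) \<le> infsum ?f (Field \<tau>) powr (1 / ?q)" if "\<alpha> \<in> Field \<tau>" for \<alpha>
    using that q by (intro powr_mono2) auto
  then show ?thesis
    using q that[of "infsum ?f (Field \<tau>) powr (1 / ?q)"] by (simp add: powr_powr)
qed

text \<open>Comparison with \<open>C powr ?q\<close> times the summable family of \<open>y\<close>.
  A constant \<open>x\<close> gives closure under scaling, and \<open>x\<close> in
  \<open>lp p \<tau>\<close> gives closure under products.\<close>

lemma lp_mult_bounded:
  assumes "y \<in> lp p \<tau>" and C: "0 \<le> C" "\<And>\<alpha>. \<alpha> \<in> Field \<tau> \<Longrightarrow> cmod (x \<alpha>) \<le> C"
  shows "(\<lambda>\<alpha>\<in>Field \<tau>. x \<alpha> * y \<alpha>) \<in> lp p \<tau>"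
proof (cases "p = top")
  case True
  with assms obtain D where "\<forall>\<alpha>\<in>Field \<tau>. cmod (y \<alpha>) \<le> D" "0 \<le> D"
    by (auto simp: mem_lp_top)
  with C have "0 \<le> C * D \<and> (\<forall>\<alpha>\<in>Field \<tau>. cmod (x \<alpha> * y \<alpha>) \<le> C * D)"
    by (auto simp: norm_mult intro: mult_mono)
  then show ?thesis
    unfolding True mem_lp_top by (auto simp: families_def intro!: exI[of _ "C * D"])
next
  case False
  let ?q = "enn2real p"
  have "(\<lambda>\<alpha>. C powr ?q * cmod (y \<alpha>) powr ?q) summable_on Field \<tau>"
    using assms False by (intro summable_on_cmult_right) (auto simp: mem_lp_finite)
  then have "(\<lambda>\<alpha>. cmod (x \<alpha> * y \<alpha>) powr ?q) summable_on Field \<tau>"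
    by (rule summable_on_comparison_test)
      (use C in \<open>auto simp: norm_mult powr_mult intro!: mult_right_mono powr_mono2\<close>)
  then show ?thesis
    unfolding mem_lp_finite[OF False] by (auto simp: families_def cong: summable_on_cong)
qed

lemma lp_scale: "x \<in> lp p \<tau> \<Longrightarrow> (\<lambda>\<alpha>\<in>Field \<tau>. c * x \<alpha>) \<in> lp p \<tau>"
  by (rule lp_mult_bounded[where C = "cmod c"]) auto

lemma lp_mult:
  assumes "x \<in> lp p \<tau>" "y \<in> lp p \<tau>" "0 < p"
  shows "(\<lambda>\<alpha>\<in>Field \<tau>. x \<alpha> * y \<alpha>) \<in> lp p \<tau>"
  using lp_bounded[OF assms(1,3)] lp_mult_bounded[OF assms(2)] by metis

definition unit_family :: "'i rel \<Rightarrow> 'i \<Rightarrow> 'i \<Rightarrow> complex" where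
  "unit_family \<tau> \<beta> = (\<lambda>\<alpha>\<in>Field \<tau>. of_bool (\<alpha> = \<beta>))"

lemma unit_family_in_lp: "unit_family \<tau> \<beta> \<in> lp p \<tau>"
proof (cases "p = top")
  case True
  then show ?thesis
    by (auto simp: mem_lp_top unit_family_def families_def intro!: exI[of _ 1])
next
  case False
  let ?f = "\<lambda>\<alpha>. cmod (unit_family \<tau> \<beta> \<alpha>) powr enn2real p"
  \<comment> \<open>This set is \<open>{\<beta>}\<close> or empty; in the latter case the unit
    family is zero on the whole index set.\<close>
  have "?f summable_on Field \<tau> \<inter> {\<beta>}"
    by (rule summable_on_finite) simp
  then have "?f summable_on Field \<tau>"
    by (rule summable_on_cong_neutral[THEN iffD1, rotated -1]) (auto simp: unit_family_def)
  with False show ?thesis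
    by (auto simp: mem_lp_finite unit_family_def families_def)
qed

lemma unit_family_self: "\<beta> \<in> Field \<tau> \<Longrightarrow> unit_family \<tau> \<beta> \<beta> = 1"
  by (simp add: unit_family_def)

lemma lp_subset_families: "x \<in> lp p \<tau> \<Longrightarrow> x \<in> families \<tau>"
  by (simp add: lp_def)

text \<open>Families are extensional, so coordinatewise formulas determine them as
  functions.\<close>

lemma families_eqI:
  assumes "x \<in> families \<tau>" "\<And>\<alpha>. \<alpha> \<in> Field \<tau> \<Longrightarrow> x \<alpha> = f \<alpha>"
  shows "x = restrict f (Field \<tau>)"
  using assms by (auto simp: families_def fun_eq_iff PiE_def extensional_def)

text \<open>The operations are pointwise, hence commute with reindexing. Closure of
  \<open>lp p \<tau>\<close> under them ensures that the restricted shift is never evaluated at an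
  argument where it is \<open>undefined\<close>.\<close>

lemma alinear_gen_shift:
  assumes "\<phi> \<in> Field \<tau> \<rightarrow> Field \<tau>" "gen_shift \<tau> \<phi> ` lp p \<tau> \<subseteq> lp p \<tau>"
  shows "alinear (lp_algebra p \<tau>) (restrict (gen_shift \<tau> \<phi>) (lp p \<tau>))"
  using assms
  by (auto simp: alinear_def lp_algebra_def lp_add lp_scale gen_shift_def fun_eq_iff)

text \<open>Linearity of all three maps is settled, so only the product rule remains; as sum and
  product are pointwise, it can be read off at each coordinate.\<close>

lemma derivation_gen_shift_iff:
  assumes p: "0 < p" and \<phi>: "\<phi> \<in> Field \<tau> \<rightarrow> Field \<tau>"
    and shift: "gen_shift \<tau> \<phi> ` lp p \<tau> \<subseteq> lp p \<tau>"
    and \<psi>: "alinear (lp_algebra p \<tau>) \<psi>" and \<Lambda>: "alinear (lp_algebra p \<tau>) \<Lambda>"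
  shows "derivation (lp_algebra p \<tau>) \<psi> \<Lambda> (restrict (gen_shift \<tau> \<phi>) (lp p \<tau>)) \<longleftrightarrow>
    (\<forall>a\<in>lp p \<tau>. \<forall>b\<in>lp p \<tau>. \<forall>\<alpha>\<in>Field \<tau>.
       a (\<phi> \<alpha>) * b (\<phi> \<alpha>) = a (\<phi> \<alpha>) * \<psi> b \<alpha> + \<Lambda> a \<alpha> * b (\<phi> \<alpha>))"
proof -
  \<comment> \<open>\<open>lp_mult\<close> places the product in the domain of the restricted
    shift.\<close>
  have "restrict (gen_shift \<tau> \<phi>) (lp p \<tau>) (\<lambda>\<alpha>\<in>Field \<tau>. a \<alpha> * b \<alpha>)
      = (\<lambda>\<alpha>\<in>Field \<tau>. a (\<phi> \<alpha>) * b (\<phi> \<alpha>))" if "a \<in> lp p \<tau>" "b \<in> lp p \<tau>" for a b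
    using that \<phi> lp_mult[OF that p] by (auto simp: gen_shift_def fun_eq_iff)
  \<comment> \<open>The nested restrictions are what unfolding \<open>aadd\<close> and
    \<open>amult\<close> leaves behind.\<close>
  moreover have "(\<lambda>\<alpha>\<in>Field \<tau>. (\<lambda>\<alpha>\<in>Field \<tau>. gen_shift \<tau> \<phi> a \<alpha> * \<psi> b \<alpha>) \<alpha>
        + (\<lambda>\<alpha>\<in>Field \<tau>. \<Lambda> a \<alpha> * gen_shift \<tau> \<phi> b \<alpha>) \<alpha>)
      = (\<lambda>\<alpha>\<in>Field \<tau>. a (\<phi> \<alpha>) * \<psi> b \<alpha> + \<Lambda> a \<alpha> * b (\<phi> \<alpha>))" for a b
    by (simp add: gen_shift_def fun_eq_iff)
  ultimately have "derivation (lp_algebra p \<tau>) \<psi> \<Lambda> (restrict (gen_shift \<tau> \<phi>) (lp p \<tau>)) \<longleftrightarrow>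
    (\<forall>a\<in>lp p \<tau>. \<forall>b\<in>lp p \<tau>. (\<lambda>\<alpha>\<in>Field \<tau>. a (\<phi> \<alpha>) * b (\<phi> \<alpha>))
       = (\<lambda>\<alpha>\<in>Field \<tau>. a (\<phi> \<alpha>) * \<psi> b \<alpha> + \<Lambda> a \<alpha> * b (\<phi> \<alpha>)))"
    using \<psi> \<Lambda> alinear_gen_shift[OF \<phi> shift] by (simp add: derivation_def lp_algebra_def)
  then show ?thesis
    by (simp add: fun_eq_iff restrict_def) meson
qed

theorem theorem2p2:
  fixes \<tau> :: "'i rel" and p :: ennreal and \<phi> :: "'i \<Rightarrow> 'i"
    and \<psi> \<Lambda> :: "('i \<Rightarrow> complex) \<Rightarrow> ('i \<Rightarrow> complex)"
  assumes "Card_order \<tau>" and "Field \<tau> \<noteq> {}"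
    and "1 \<le> p"
    and "\<phi> \<in> Field \<tau> \<rightarrow> Field \<tau>"
    and "gen_shift \<tau> \<phi> ` lp p \<tau> \<subseteq> lp p \<tau>"
    and "alinear (lp_algebra p \<tau>) \<psi>" and "acontinuous (lp_algebra p \<tau>) \<psi>"
    and "alinear (lp_algebra p \<tau>) \<Lambda>" and "acontinuous (lp_algebra p \<tau>) \<Lambda>"
  shows "derivation (lp_algebra p \<tau>) \<psi> \<Lambda> (restrict (gen_shift \<tau> \<phi>) (lp p \<tau>)) \<longleftrightarrow>
    (\<exists>r\<in>families \<tau>. \<forall>x\<in>lp p \<tau>.
       \<psi> x = (\<lambda>\<alpha>\<in>Field \<tau>. r \<alpha> * x (\<phi> \<alpha>)) \<and>
       \<Lambda> x = (\<lambda>\<alpha>\<in>Field \<tau>. (1 - r \<alpha>) * x (\<phi> \<alpha>)))"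
proof -
  have p: "0 < p"
    using assms(3) by (auto intro: less_le_trans[of 0 1])
  let ?e = "\<lambda>\<alpha>. unit_family \<tau> (\<phi> \<alpha>)"
  have e: "?e \<alpha> (\<phi> \<alpha>) = 1" if "\<alpha> \<in> Field \<tau>" for \<alpha>
    using funcset_mem[OF assms(4) that] by (rule unit_family_self)
  \<comment> \<open>Extensionality of the values, which \<open>families_eqI\<close> requires at the
    end.\<close>
  have maps: "\<psi> x \<in> families \<tau>" "\<Lambda> x \<in> families \<tau>" if "x \<in> lp p \<tau>" for x
    using that assms(6,8) by (auto simp: alinear_def lp_algebra_def intro!: lp_subset_families)
  show ?thesis
    unfolding derivation_gen_shift_iff[OF p assms(4,5,6,8)]
  proof
    assume deriv: "\<forall>a\<in>lp p \<tau>. \<forall>b\<in>lp p \<tau>. \<forall>\<alpha>\<in>Field \<tau>.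
      a (\<phi> \<alpha>) * b (\<phi> \<alpha>) = a (\<phi> \<alpha>) * \<psi> b \<alpha> + \<Lambda> a \<alpha> * b (\<phi> \<alpha>)"
    \<comment> \<open>The test vector changes with the coordinate: entry \<open>\<alpha>\<close> of
      \<open>r\<close> comes from the unit vector at \<open>\<phi> \<alpha>\<close>.\<close>
    define r where "r = (\<lambda>\<alpha>\<in>Field \<tau>. \<psi> (?e \<alpha>) \<alpha>)"
    have \<Lambda>_eq: "\<Lambda> x \<alpha> = (1 - r \<alpha>) * x (\<phi> \<alpha>)" if "x \<in> lp p \<tau>" "\<alpha> \<in> Field \<tau>" for x \<alpha>
      using deriv[rule_format, OF that(1) unit_family_in_lp that(2), of "\<phi> \<alpha>"] that
      by (simp add: e r_def algebra_simps)
    have \<psi>_eq: "\<psi> x \<alpha> = r \<alpha> * x (\<phi> \<alpha>)" if "x \<in> lp p \<tau>" "\<alpha> \<in> Field \<tau>" for x \<alpha>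
      using deriv[rule_format, OF unit_family_in_lp that, of "\<phi> \<alpha>"] that
        \<Lambda>_eq[OF unit_family_in_lp that(2), of "\<phi> \<alpha>"]
      by (simp add: e algebra_simps)
    have "r \<in> families \<tau>"
      by (simp add: r_def families_def)
    then show "\<exists>r\<in>families \<tau>. \<forall>x\<in>lp p \<tau>. \<psi> x = (\<lambda>\<alpha>\<in>Field \<tau>. r \<alpha> * x (\<phi> \<alpha>)) \<and>
        \<Lambda> x = (\<lambda>\<alpha>\<in>Field \<tau>. (1 - r \<alpha>) * x (\<phi> \<alpha>))"
      using \<psi>_eq \<Lambda>_eq maps by (intro bexI[of _ r] ballI conjI families_eqI)
  \<comment> \<open>Converse: at each coordinate the two products carry the weights
    \<open>r \<alpha>\<close> and \<open>1 - r \<alpha>\<close>, which add up to 1.\<close>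
  qed (auto simp: algebra_simps)
qed

end
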